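(* Let $k \ge 3$ be an integer, and let $\ell$ be the largest integer satisfying $2k > 2^{\ell}$. There is a constant $C>0$ (depending only on $k$) such that for all integers $n \ge 2$, $$ c_{n,k} \ \ge\ C\, k^n \left(\frac{r_k(\sqrt{n})}{\sqrt{n}}\right)^{k-1}, $$ and, as a consequence, $c_{n,k} \ge k^n \exp\left(-O\left((\log n)^{1/\ell}\right)\right)$, where the implied constant depends only on $k$. More specifically, with all logarithms taken to base $k$, $$ c_{n,k} \ \ge\ C\, k^{\,n-\alpha(k) (\log n)^{1/\ell} + \beta(k) \log\log n} \qquad (n \ge 2),$$ where $\alpha(k) = (k-1)(\log 2)^{1-1/\ell}\, \ell\, 2^{(\ell-1)/2-1/\ell}$ and $\beta(k) = (k-1)/(2\ell)$.
   Context: For integers $k\ge 1$, $n \ge 0$, $[k] := \{1,\dots,k\}$ and $[k]^n$ is the set of words of length $n$ over the alphabet $[k]$. A combinatorial line in $[k]^n$ is a set $\{w(i): i=1,\dots,k\}$, where $w \in ([k]\cup\{x\})^n \setminus [k]^n$ is a word containing the wildcard $x$ at least once, and $w(i)$ is obtained from $w$ by replacing every occurrence of $x$ by $i$. A set $A \subset [k]^n$ is line-free if it contains no combinatorial line (as a subset). $c_{n,k}$ denotes the maximum cardinality of a line-free subset of $[k]^n$. For a positive integer $m$, $r_k(m)$ is the maximum size of a subset of $\{1,\dots,m\}$ containing no (nonconstant) $k$-term arithmetic progression; $r_k(\sqrt n)$ means $r_k(\lfloor \sqrt n\rfloor)$. *)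

theory Defs
  imports Complex_Main
begin

definition words :: "nat \<Rightarrow> nat \<Rightarrow> nat list set" where
  "words k n = {w. set w \<subseteq> {1..k} \<and> length w = n}"

text \<open>Words with wildcard: \<open>None\<close> is the wildcard, \<open>Some a\<close> the letter \<open>a\<close>.\<close>

definition templates :: "nat \<Rightarrow> nat \<Rightarrow> nat option list set" where
  "templates k n =
    {w. set w \<subseteq> insert None (Some ` {1..k}) \<and> length w = n \<and> None \<in> set w}"

definition fill :: "nat option list \<Rightarrow> nat \<Rightarrow> nat list" where
  "fill w i = map (case_option i id) w"

definition combinatorial_line :: "nat \<Rightarrow> nat \<Rightarrow> nat list set \<Rightarrow> bool" where
  "combinatorial_line k n L \<longleftrightarrow> (\<exists>w \<in> templates k n. L = fill w ` {1..k})"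

definition line_free :: "nat \<Rightarrow> nat \<Rightarrow> nat list set \<Rightarrow> bool" where
  "line_free k n A \<longleftrightarrow> A \<subseteq> words k n \<and> \<not> (\<exists>L. combinatorial_line k n L \<and> L \<subseteq> A)"

definition c_num :: "nat \<Rightarrow> nat \<Rightarrow> nat" where
  "c_num n k = Max {card A | A. line_free k n A}"

text \<open>A progression of negative difference, read backwards, has positive difference and
  the same terms, so only \<open>d > 0\<close> has to be excluded.\<close>

definition ap_free :: "nat \<Rightarrow> nat set \<Rightarrow> bool" where
  "ap_free k A \<longleftrightarrow> \<not> (\<exists>a d. d > 0 \<and> (\<forall>i<k. a + i * d \<in> A))"

definition r_num :: "nat \<Rightarrow> nat \<Rightarrow> nat" where
  "r_num k m = Max {card A | A. A \<subseteq> {1..m} \<and> ap_free k A}"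

definition alpha :: "nat \<Rightarrow> nat \<Rightarrow> real" where
  "alpha k l = (real k - 1) * log (real k) 2 powr (1 - 1 / real l) * real l
     * 2 powr ((real l - 1) / 2 - 1 / real l)"

definition beta :: "nat \<Rightarrow> nat \<Rightarrow> real" where
  "beta k l = (real k - 1) / (2 * real l)"

end

theory Submission
  imports Defs "HOL-Computational_Algebra.Polynomial" "HOL-Real_Asymp.Real_Asymp"
begin

text \<open>
  Along a combinatorial line with \<open>r > 0\<close> wildcards the sum of the
  letters runs through a \<open>k\<close>-term arithmetic progression with difference \<open>r\<close>. So the words whose
  letter sum lies in a translate of a progression-free set \<open>S\<close> form a line-free set. The letter sum
  of a random word has variance of order \<open>n\<close>, hence lies for at least half of all words in an interval
  of length \<open>O(\<surd>n)\<close>. Averaging over the translates of an optimal \<open>S \<subseteq> {1..\<lfloor>\<surd>n\<rfloor>}\<close> gives a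
  translate that catches a proportion of order \<open>r\<^sub>k(\<surd>n) / \<surd>n\<close> of the words
  (\<open>c_num_ge_r_num\<close>). This ratio is at most 1, so its power with exponent \<open>k - 1\<close> is smaller still,
  which is the first claim.

  The other two claims follow from a lower bound for \<open>r\<^sub>k\<close>. Because the
  ratio enters above with exponent 1, while the stated bound has the factor \<open>k - 1 \<ge> 2\<^bsup>l-1\<^esup>\<close> in
  \<open>alpha\<close>, it suffices to have \<open>r\<^sub>k(N) \<ge> N \<cdot> 2 powr -(a (log\<^sub>2 N)\<^bsup>1/l\<^esup> + C)\<close> for some
  constant \<open>a < (k - 1) l 2\<^bsup>(l-1)/2\<^esup>\<close>. The strict inequality also pays for the double
  logarithm, since \<open>log u\<close> grows more slowly than any multiple of \<open>u\<^bsup>1/l\<^esup>\<close>.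

  Rankin's construction gives such a bound, with \<open>a = 1 + 3 (2\<^bsup>l-1\<^esup> - 1)\<close>, by an induction
  over sets that contain no nonconstant progression \<open>P(0), \<dots>, P(k-1)\<close> with \<open>P\<close> a polynomial of
  degree at most \<open>D\<close> (\<open>poly_prog_free\<close>). Write numbers with \<open>d\<close> digits below \<open>b\<close> in base
  \<open>2\<^sup>D b\<close>. A vanishing \<open>(D+1)\<close>-st difference of the numbers forces the same for each digit, since no
  carries can occur, so each digit is itself a polynomial in \<open>i\<close> of degree at most \<open>D\<close>, and the sum of the
  squared digits is one of degree at most \<open>2D\<close>. If these sums are restricted to a set without
  progressions of degree \<open>2D\<close>, the sum of squares is constant, and then so is every digit. This
  step (\<open>poly_prog_free_lift\<close>) doubles the degree; \<open>l - 1\<close> such steps lead from degree 1 to degree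
  \<open>2\<^bsup>l-1\<^esup> < k\<close>, where a singleton will do (\<open>poly_prog_free_dense\<close>).
\<close>

section \<open>Finite differences and polynomials\<close>

definition fdiff :: "(nat \<Rightarrow> 'a::comm_ring_1) \<Rightarrow> nat \<Rightarrow> 'a" where
  "fdiff f i = f (Suc i) - f i"

lemma fdiff_pow_Suc:
  "(fdiff ^^ Suc n) f i = (fdiff ^^ n) f (Suc i) - (fdiff ^^ n) f i"
  unfolding funpow.simps comp_apply by (rule fdiff_def)

lemma fdiff_pow_cong:
  assumes "\<And>j. i \<le> j \<Longrightarrow> j \<le> i + n \<Longrightarrow> f j = g j"
  shows "(fdiff ^^ n) f i = (fdiff ^^ n) g i"
  using assms
proof (induction n arbitrary: i)
  case (Suc n)
  have "(fdiff ^^ n) f i = (fdiff ^^ n) g i" "(fdiff ^^ n) f (Suc i) = (fdiff ^^ n) g (Suc i)"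
    by (intro Suc.IH; simp add: Suc.prems)+
  then show ?case by (simp only: fdiff_pow_Suc)
qed simp

lemma fdiff_pow_linear:
  "(fdiff ^^ n) (\<lambda>i. f i + c * g i) i = (fdiff ^^ n) f i + c * (fdiff ^^ n) g i"
  by (induction n arbitrary: i) (simp_all add: fdiff_pow_Suc algebra_simps del: funpow.simps(2))

lemma fdiff_pow_of_int:
  "(fdiff ^^ n) (\<lambda>i. of_int (f i)) i = of_int ((fdiff ^^ n) f i)"
  by (induction n arbitrary: i) (simp_all add: fdiff_pow_Suc del: funpow.simps(2))

text \<open>The first difference of values in \<open>[0, b)\<close> is below \<open>b\<close> in modulus, and each further one at most doubles
  the bound. Bounding all \<open>n + 1\<close> differences by the triangle inequality from the start would give the
  weaker \<open>2\<^bsup>n+1\<^esup> b\<close> and double the base needed later.\<close>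

lemma fdiff_pow_bound:
  fixes f :: "nat \<Rightarrow> int"
  assumes "\<And>j. i \<le> j \<Longrightarrow> j \<le> i + Suc n \<Longrightarrow> 0 \<le> f j \<and> f j < b"
  shows "\<bar>(fdiff ^^ Suc n) f i\<bar> < 2 ^ n * b"
  using assms
proof (induction n arbitrary: i)
  case 0
  from 0[of i] 0[of "Suc i"] show ?case by (simp add: fdiff_def abs_less_iff)
next
  case (Suc n)
  have "\<bar>(fdiff ^^ Suc n) f i\<bar> < 2 ^ n * b" "\<bar>(fdiff ^^ Suc n) f (Suc i)\<bar> < 2 ^ n * b"
    by (intro Suc.IH Suc.prems; simp)+
  moreover have "(fdiff ^^ Suc (Suc n)) f i = (fdiff ^^ Suc n) f (Suc i) - (fdiff ^^ Suc n) f i"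
    by (rule fdiff_pow_Suc)
  ultimately show ?case unfolding power_Suc by linarith
qed

text \<open>The difference \<open>p(x + 1) - p(x)\<close> has smaller degree than \<open>p\<close>, because the leading terms cancel.\<close>

lemma fdiff_pow_poly:
  fixes p :: "real poly"
  assumes "degree p < n"
  shows "(fdiff ^^ n) (\<lambda>i. poly p (real i)) i = 0"
  using assms
proof (induction n arbitrary: p)
  case (Suc n)
  define q where "q = pcompose p [:1, 1:] - p"
  have q: "fdiff (\<lambda>i. poly p (real i)) = (\<lambda>i. poly q (real i))"
    by (rule ext) (simp add: fdiff_def q_def poly_pcompose)
  have "(fdiff ^^ n) (\<lambda>i. poly q (real i)) i = 0"
  proof (cases "degree p = 0")
    case True
    then obtain a where "p = [:a:]" by (rule degree_eq_zeroE)
    then have "(\<lambda>i. poly q (real i)) = (\<lambda>i. 0)" by (simp add: q_def)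
    moreover have "(fdiff ^^ n) (\<lambda>i. 0::real) j = 0" for j
      by (induction n arbitrary: j) (simp_all add: fdiff_def)
    ultimately show ?thesis by simp
  next
    case False
    have "degree q \<le> degree p"
      unfolding q_def by (rule degree_diff_le) (simp_all add: degree_pcompose)
    moreover have "coeff q (degree p) = 0"
      using lead_coeff_comp[of "[:1, 1::real:]" p] by (simp add: q_def degree_pcompose)
    ultimately have "degree q < degree p"
      using False by (metis degree_0 leading_coeff_0_iff nat_less_le neq0_conv)
    then show ?thesis using Suc.prems by (intro Suc.IH) simp
  qed
  then show ?case by (simp add: funpow_Suc_right q del: funpow.simps)
qed simp

lemma interpolation_at_naturals:
  fixes f :: "nat \<Rightarrow> real"
  shows "\<exists>p. degree p \<le> n \<and> (\<forall>i\<le>n. poly p (real i) = f i)"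
proof (induction n)
  case 0
  show ?case by (intro exI[of _ "[:f 0:]"]) simp
next
  case (Suc n)
  then obtain p where p: "degree p \<le> n" "\<And>i. i \<le> n \<Longrightarrow> poly p (real i) = f i" by blast
  define w where "w = (\<Prod>i\<le>n. [:- real i, 1:])"
  have pw: "poly w x = (\<Prod>i\<le>n. x - real i)" for x
    by (simp add: w_def poly_prod)
  have nz: "poly w (real (Suc n)) \<noteq> 0" unfolding pw by auto
  have z: "poly w (real i) = 0" if "i \<le> n" for i
    unfolding pw using that by auto
  have dw: "degree w \<le> Suc n"
    unfolding w_def by (rule order_trans[OF degree_prod_sum_le]) auto
  define c where "c = (f (Suc n) - poly p (real (Suc n))) / poly w (real (Suc n))"
  have "degree (p + smult c w) \<le> Suc n"
    using p(1) dw by (intro degree_add_le) (auto intro: order_trans[OF degree_smult_le])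
  moreover have "poly (p + smult c w) (real i) = f i" if "i \<le> Suc n" for i
  proof (cases "i = Suc n")
    case True
    then show ?thesis using nz by (simp add: c_def)
  next
    case False
    then show ?thesis using that p(2)[of i] z[of i] by simp
  qed
  ultimately show ?case by blast
qed

text \<open>The difference equation determines a sequence from its first \<open>n\<close> values. By induction the first
  difference vanishes, so the sequence is constant.\<close>

lemma fdiff_pow_zero_unique:
  fixes g :: "nat \<Rightarrow> 'a::comm_ring_1"
  assumes "\<And>i. i + n < k \<Longrightarrow> (fdiff ^^ n) g i = 0" and "\<And>i. i < n \<Longrightarrow> g i = 0" and "i < k"
  shows "g i = 0"
  using assms
proof (induction n arbitrary: g i k)
  case (Suc n)
  have "fdiff g j = 0" if "Suc j < k" for j
  proof (rule Suc.IH[where k = "k - 1"])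
    show "(fdiff ^^ n) (fdiff g) m = 0" if "m + n < k - 1" for m
      using Suc.prems(1)[of m] that by (simp add: funpow_Suc_right del: funpow.simps)
  qed (use that Suc.prems(2) in \<open>auto simp: fdiff_def\<close>)
  then have "g (Suc j) = g j" if "Suc j < k" for j
    using that by (simp add: fdiff_def)
  with \<open>i < k\<close> show ?case
    by (induction i) (use Suc.prems(2) in auto)
qed simp

text \<open>The converse of \<open>fdiff_pow_poly\<close>: interpolate at \<open>0, \<dots>, D\<close> and apply uniqueness to the error.\<close>

lemma fdiff_pow_zero_imp_poly:
  fixes f :: "nat \<Rightarrow> real"
  assumes "\<And>i. i + Suc D < k \<Longrightarrow> (fdiff ^^ Suc D) f i = 0"
  shows "\<exists>p. degree p \<le> D \<and> (\<forall>i<k. poly p (real i) = f i)"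
proof -
  obtain p where p: "degree p \<le> D" "\<And>i. i \<le> D \<Longrightarrow> poly p (real i) = f i"
    using interpolation_at_naturals[of D f] by blast
  define g where "g i = f i + (-1) * poly p (real i)" for i
  have g: "g i = 0" if "i < k" for i
  proof (rule fdiff_pow_zero_unique[of "Suc D" k])
    fix i assume "i + Suc D < k"
    then show "(fdiff ^^ Suc D) g i = 0"
      unfolding g_def using assms[of i] fdiff_pow_poly[of p "Suc D" i] p(1)
      by (subst fdiff_pow_linear) simp
  qed (use p that in \<open>auto simp: g_def\<close>)
  show ?thesis
    using p(1) g by (intro exI[of _ p]) (auto simp: g_def)
qed

section \<open>Digits\<close>

fun digits_value :: "nat \<Rightarrow> nat list \<Rightarrow> nat" where
  "digits_value B [] = 0"
| "digits_value B (x # xs) = x + B * digits_value B xs"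

lemma digits_value_less:
  "set xs \<subseteq> {..<B} \<Longrightarrow> digits_value B xs < B ^ length xs"
proof (induction xs)
  case (Cons x xs)
  then have "x < B" "Suc (digits_value B xs) \<le> B ^ length xs" by auto
  then have "x + B * digits_value B xs < B * Suc (digits_value B xs)" by simp
  also have "\<dots> \<le> B * B ^ length xs"
    using \<open>Suc _ \<le> _\<close> by (rule mult_le_mono2)
  finally show ?case by simp
qed simp

lemma inj_on_digits_value:
  "inj_on (digits_value B) {xs. set xs \<subseteq> {..<B} \<and> length xs = d}"
proof (rule inj_onI; clarify)
  fix xs ys
  assume "set xs \<subseteq> {..<B}" "set ys \<subseteq> {..<B}" "length ys = length xs"
    "digits_value B xs = digits_value B ys"
  then show "xs = ys"
  proof (induction xs arbitrary: ys)
    case (Cons x xs)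
    then obtain y ys' where ys: "ys = y # ys'" by (cases ys) auto
    from Cons.prems ys have less: "x < B" "y < B" by auto
    have eq: "x + B * digits_value B xs = y + B * digits_value B ys'"
      using Cons.prems ys by simp
    have "x = y" using arg_cong[OF eq, of "\<lambda>u. u mod B"] less by simp
    with eq less have "digits_value B xs = digits_value B ys'" by simp
    with Cons ys \<open>x = y\<close> show ?case by auto
  qed simp
qed

text \<open>Digits below \<open>b\<close> in a base \<open>B \<ge> 2\<^sup>D b\<close> leave room for \<open>D + 1\<close> differences: the difference of
  the lowest digit is a multiple of \<open>B\<close> of modulus below \<open>B\<close>, hence 0. The argument then passes to the
  remaining digits.\<close>

lemma fdiff_pow_digits_zero:
  fixes X :: "nat \<Rightarrow> nat list"
  assumes "\<And>i. i < k \<Longrightarrow> set (X i) \<subseteq> {..<b} \<and> length (X i) = d"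
    and "\<And>i. i + Suc D < k \<Longrightarrow> (fdiff ^^ Suc D) (\<lambda>i. int (digits_value B (X i))) i = 0"
    and "2 ^ D * b \<le> B" and "j < d" and "i + Suc D < k"
  shows "(fdiff ^^ Suc D) (\<lambda>i. int (X i ! j)) i = 0"
  using assms
proof (induction d arbitrary: X j i)
  case (Suc d)
  define h where "h i = int (hd (X i))" for i
  define Y where "Y i = tl (X i)" for i
  let ?v = "\<lambda>i. int (digits_value B (Y i))"
  have X: "X i = hd (X i) # Y i" "set (Y i) \<subseteq> {..<b}" "length (Y i) = d" "hd (X i) < b"
    if "i < k" for i
    using Suc.prems(1)[OF that] unfolding Y_def by (cases "X i"; auto)+
  have split: "(fdiff ^^ Suc D) h i + int B * (fdiff ^^ Suc D) ?v i = 0"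
    if "i + Suc D < k" for i
  proof -
    have "(fdiff ^^ Suc D) (\<lambda>i. h i + int B * ?v i) i
        = (fdiff ^^ Suc D) (\<lambda>i. int (digits_value B (X i))) i"
    proof (rule fdiff_pow_cong)
      fix j assume "j \<le> i + Suc D"
      then have "j < k" using that by simp
      show "h j + int B * ?v j = int (digits_value B (X j))"
        using arg_cong[OF X(1)[OF \<open>j < k\<close>], of "digits_value B"] by (simp add: h_def)
    qed
    then show ?thesis using Suc.prems(2)[OF that] by (subst (asm) fdiff_pow_linear) simp
  qed
  have hz: "(fdiff ^^ Suc D) h i = 0" if "i + Suc D < k" for i
  proof (rule ccontr)
    assume nz: "(fdiff ^^ Suc D) h i \<noteq> 0"
    have "\<bar>(fdiff ^^ Suc D) h i\<bar> < 2 ^ D * int b"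
      by (rule fdiff_pow_bound) (use X(4) that in \<open>auto simp: h_def\<close>)
    also have "\<dots> \<le> int B" using of_nat_mono[OF Suc.prems(3), where 'a = int] by simp
    finally have less: "\<bar>(fdiff ^^ Suc D) h i\<bar> < int B" .
    have "(fdiff ^^ Suc D) h i = int B * (- (fdiff ^^ Suc D) ?v i)"
      using split[OF that] by simp
    then have "int B dvd (fdiff ^^ Suc D) h i" by (metis dvd_triv_left)
    then have "\<bar>int B\<bar> \<le> \<bar>(fdiff ^^ Suc D) h i\<bar>" using nz by (intro dvd_imp_le_int)
    with less show False by simp
  qed
  have B0: "B > 0"
  proof -
    have "b > 0" using X(4)[of i] Suc.prems(5) by simp
    then have "2 ^ D * b > 0" by simp
    then show ?thesis using Suc.prems(3) by linarith
  qed
  have vz: "(fdiff ^^ Suc D) ?v i = 0" if "i + Suc D < k" for i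
    using split[OF that] hz[OF that] B0 by simp
  show ?case
  proof (cases j)
    case 0
    have "(fdiff ^^ Suc D) (\<lambda>i. int (X i ! j)) i = (fdiff ^^ Suc D) h i"
    proof (rule fdiff_pow_cong)
      fix m assume "m \<le> i + Suc D"
      then have "X m \<noteq> []" using X(1)[of m] Suc.prems(5) by auto
      then show "int (X m ! j) = h m" using 0 by (simp add: h_def hd_conv_nth)
    qed
    then show ?thesis using hz Suc.prems(5) by simp
  next
    case (Suc j')
    have "(fdiff ^^ Suc D) (\<lambda>i. int (X i ! j)) i = (fdiff ^^ Suc D) (\<lambda>i. int (Y i ! j')) i"
    proof (rule fdiff_pow_cong)
      fix m assume "m \<le> i + Suc D"
      then have "X m = hd (X m) # Y m" using X(1)[of m] Suc.prems(5) by auto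
      then show "int (X m ! j) = int (Y m ! j')" using Suc by (metis nth_Cons_Suc)
    qed
    also have "\<dots> = 0"
      by (rule Suc.IH) (use X vz Suc.prems Suc in auto)
    finally show ?thesis .
  qed
qed simp

section \<open>Sums of squares\<close>

lemma coeff_power2_double:
  fixes p :: "real poly"
  assumes "degree p \<le> m"
  shows "coeff (p\<^sup>2) (2 * m) = (coeff p m)\<^sup>2"
proof (cases "degree p = m")
  case True
  then show ?thesis
    using coeff_mult_degree_sum[of p p] by (simp add: power2_eq_square mult_2)
next
  case False
  then have "degree (p\<^sup>2) < 2 * m"
    using assms degree_power_le[of p 2] by simp
  with False assms show ?thesis by (simp add: coeff_eq_0)
qed

text \<open>If \<open>m\<close> is the largest degree of the \<open>p j\<close>, the coefficient of \<open>x\<^bsup>2m\<^esup>\<close> in the sum is a sum of real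
  squares, not all zero. No cancellation can hide a nonconstant \<open>p j\<close>.\<close>

lemma degree_zero_if_sum_squares_const:
  fixes p :: "nat \<Rightarrow> real poly"
  assumes "degree (\<Sum>j<d. (p j)\<^sup>2) = 0" and "j < d"
  shows "degree (p j) = 0"
proof (rule ccontr)
  assume j: "degree (p j) \<noteq> 0"
  define m where "m = Max ((\<lambda>j. degree (p j)) ` {..<d})"
  have le: "degree (p i) \<le> m" if "i < d" for i
    unfolding m_def using that by (intro Max_ge) auto
  have "m \<in> (\<lambda>j. degree (p j)) ` {..<d}"
    unfolding m_def using \<open>j < d\<close> by (intro Max_in) auto
  then obtain i where i: "i < d" "degree (p i) = m" by auto
  have "m > 0" using j le[OF \<open>j < d\<close>] by linarith
  have "coeff (\<Sum>j<d. (p j)\<^sup>2) (2 * m) = (\<Sum>j<d. (coeff (p j) m)\<^sup>2)"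
    using le by (simp add: coeff_sum coeff_power2_double)
  also have "\<dots> > 0"
  proof (rule sum_pos2[of _ i])
    show "(coeff (p i) m)\<^sup>2 > 0" using i \<open>m > 0\<close> by (metis degree_0 leading_coeff_0_iff nat_neq_iff zero_less_power2)
  qed (use i in auto)
  finally have "2 * m \<le> degree (\<Sum>j<d. (p j)\<^sup>2)" by (intro le_degree) simp
  then show False using assms(1) \<open>m > 0\<close> by simp
qed

section \<open>Averaging over translates\<close>

text \<open>Every \<open>x\<close> satisfies \<open>f x + t \<in> S\<close> for exactly \<open>card S\<close> translations \<open>t\<close>, all of them in \<open>T\<close>. The
  bound is the average over \<open>t \<in> T\<close>.\<close>

lemma exists_good_translate:
  fixes f :: "'a \<Rightarrow> int" and S T :: "int set"
  assumes "finite X" "finite S" "finite T" "T \<noteq> {}"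
    and "\<And>x s. x \<in> X \<Longrightarrow> s \<in> S \<Longrightarrow> s - f x \<in> T"
  shows "\<exists>t\<in>T. card X * card S \<le> card T * card {x \<in> X. f x + t \<in> S}"
proof -
  have "card {t \<in> T. f x + t \<in> S} = card S" if "x \<in> X" for x
  proof -
    have "{t \<in> T. f x + t \<in> S} = (\<lambda>s. s - f x) ` S"
      using assms(5)[OF that] by (force simp: image_iff algebra_simps)
    then show ?thesis by (simp add: card_image inj_on_def)
  qed
  then have "card X * card S = (\<Sum>x\<in>X. card {t \<in> T. f x + t \<in> S})" by simp
  also have "\<dots> = (\<Sum>x\<in>X. \<Sum>t\<in>T. if f x + t \<in> S then 1 else 0)"
    using assms by (simp add: sum.If_cases Int_def)
  also have "\<dots> = (\<Sum>t\<in>T. \<Sum>x\<in>X. if f x + t \<in> S then 1 else 0)" by (rule sum.swap)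
  also have "\<dots> = (\<Sum>t\<in>T. card {x \<in> X. f x + t \<in> S})"
    using assms by (simp add: sum.If_cases Int_def)
  finally have eq: "card X * card S = (\<Sum>t\<in>T. card {x \<in> X. f x + t \<in> S})" .
  show ?thesis
  proof (rule ccontr)
    assume "\<not> ?thesis"
    then have less: "card T * card {x \<in> X. f x + t \<in> S} < card X * card S" if "t \<in> T" for t
      using that by force
    have "card T * (card X * card S) = (\<Sum>t\<in>T. card T * card {x \<in> X. f x + t \<in> S})"
      by (simp add: eq sum_distrib_left)
    also have "\<dots> < (\<Sum>t\<in>T. card X * card S)"
      using assms less by (intro sum_strict_mono) auto
    finally show False by simp
  qed
qed

section \<open>Sets without polynomial progressions\<close>

text \<open>Real coefficients cost nothing here and spare all questions of integrality of the digit polynomials. For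
  \<open>k > D\<close> the condition \<open>degree p = 0\<close> says that the progression itself is constant.\<close>

definition poly_prog_free :: "nat \<Rightarrow> nat \<Rightarrow> nat set \<Rightarrow> bool" where
  "poly_prog_free k D A \<longleftrightarrow>
     (\<forall>p :: real poly. degree p \<le> D \<longrightarrow> (\<forall>i<k. poly p (real i) \<in> real ` A) \<longrightarrow> degree p = 0)"

lemma poly_eq_if_agree:
  fixes p q :: "real poly"
  assumes "degree p \<le> D" "degree q \<le> D" "D < k" "\<And>i. i < k \<Longrightarrow> poly p (real i) = poly q (real i)"
  shows "p = q"
proof (rule ccontr)
  assume "p \<noteq> q"
  then have nz: "p - q \<noteq> 0" by simp
  have "real ` {..<k} \<subseteq> {x. poly (p - q) x = 0}" using assms(4) by auto
  then have "card (real ` {..<k}) \<le> card {x. poly (p - q) x = 0}"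
    using nz by (intro card_mono poly_roots_finite)
  also have "\<dots> \<le> degree (p - q)" using nz by (rule card_poly_roots_bound)
  also have "\<dots> \<le> D" using assms by (intro degree_diff_le)
  finally show False using assms(3) by (simp add: card_image)
qed

lemma poly_prog_free_singleton:
  assumes "D < k"
  shows "poly_prog_free k D {a}"
  unfolding poly_prog_free_def
proof (intro allI impI)
  fix p :: "real poly" assume "degree p \<le> D" "\<forall>i<k. poly p (real i) \<in> real ` {a}"
  then have "p = [:real a:]" using assms by (intro poly_eq_if_agree[of p D _ k]) auto
  then show "degree p = 0" by simp
qed

lemma ap_free_if_poly_prog_free:
  assumes "poly_prog_free k 1 A"
  shows "ap_free k A"
  unfolding ap_free_def
proof clarify
  fix a d :: nat assume "d > 0" "\<forall>i<k. a + i * d \<in> A"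
  then have "\<forall>i<k. poly [:real a, real d:] (real i) \<in> real ` A"
    by (auto simp: image_iff mult_ac intro!: bexI[of _ "a + _ * d"])
  then have "degree [:real a, real d:] = 0"
    using assms unfolding poly_prog_free_def by (metis One_nat_def degree_pCons_le degree_pCons_0 )
  with \<open>d > 0\<close> show False by simp
qed

text \<open>One step of Rankin's construction. The set \<open>A\<close> consists of the numbers with digits below \<open>b\<close> whose sum of
  squared digits lies in a translate of \<open>A'\<close>. These sums lie in \<open>[0, d b\<^sup>2)\<close>, so fewer than
  \<open>2 d b\<^sup>2\<close> translates compete, and the best one keeps the density of \<open>A'\<close> up to a factor 2.\<close>

lemma poly_prog_free_lift:
  assumes "D < k" "b > 0" "d > 0" and A': "A' \<subseteq> {1..d * b\<^sup>2}" "poly_prog_free k (2 * D) A'"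
  shows "\<exists>A \<subseteq> {1..(2 ^ D * b) ^ d}. poly_prog_free k D A
           \<and> b ^ d * card A' \<le> 2 * (d * b\<^sup>2) * card A"
proof -
  define B M where "B = 2 ^ D * b" and "M = d * b\<^sup>2"
  define V where "V = {xs :: nat list. set xs \<subseteq> {..<b} \<and> length xs = d}"
  define N2 where "N2 xs = sum_list (map power2 xs)" for xs :: "nat list"
  have "finite V" unfolding V_def by (rule finite_lists_length_eq) simp
  have cV: "card V = b ^ d" unfolding V_def by (subst card_lists_length_eq) auto
  have "b \<le> B" by (simp add: B_def)
  have "finite A'" using A'(1) finite_subset by blast
  have N2: "N2 xs < M" if "xs \<in> V" for xs
  proof -
    have "N2 xs \<le> sum_list (map (\<lambda>_. (b - 1)\<^sup>2) xs)"
      unfolding N2_def using that by (intro sum_list_mono power_mono) (auto simp: V_def)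
    also have "\<dots> = d * (b - 1)\<^sup>2" using that by (simp add: V_def sum_list_triv)
    also have "\<dots> < M" using assms unfolding M_def by (intro mult_strict_left_mono power_strict_mono) auto
    finally show ?thesis .
  qed
  let ?S = "int ` A'" and ?T = "{1 - int M<..int M}"
  have "M > 0" using assms by (simp add: M_def)
  have "\<exists>t\<in>?T. card V * card ?S \<le> card ?T * card {xs \<in> V. int (N2 xs) + t \<in> ?S}"
  proof (rule exists_good_translate)
    fix xs s assume "xs \<in> V" "s \<in> int ` A'"
    then show "s - int (N2 xs) \<in> ?T" using N2[of xs] A'(1)[folded M_def] by fastforce
  qed (use \<open>M > 0\<close> \<open>finite V\<close> \<open>finite A'\<close> in auto)
  then obtain t where t: "card V * card ?S \<le> card ?T * card {xs \<in> V. int (N2 xs) + t \<in> ?S}"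
    by blast
  define W where "W = {xs \<in> V. int (N2 xs) + t \<in> ?S}"
  \<comment> \<open>The value 0 is possible, and the shift by one brings the numbers into the range from 1.\<close>
  define A where "A = Suc ` digits_value B ` W"
  have VB: "V \<subseteq> {xs. set xs \<subseteq> {..<B} \<and> length xs = d}"
    using \<open>b \<le> B\<close> by (force simp: V_def)
  have "inj_on (digits_value B) W"
    by (rule inj_on_subset[OF inj_on_digits_value[of B d]]) (use VB in \<open>auto simp: W_def\<close>)
  then have cA: "card A = card W" by (simp add: A_def card_image)
  have "A \<subseteq> {1..B ^ d}"
    using VB digits_value_less by (fastforce simp: A_def W_def Suc_le_eq)
  moreover have "b ^ d * card A' \<le> 2 * M * card A"
  proof -
    have "b ^ d * card A' \<le> card ?T * card A"
      using t by (simp add: cV cA W_def card_image)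
    also have "\<dots> \<le> 2 * M * card A" by (intro mult_right_mono) auto
    finally show ?thesis .
  qed
  moreover have "poly_prog_free k D A"
    unfolding poly_prog_free_def
  proof (intro allI impI)
    fix P :: "real poly"
    assume P: "degree P \<le> D" "\<forall>i<k. poly P (real i) \<in> real ` A"
    have "\<forall>i. \<exists>xs. i < k \<longrightarrow> xs \<in> W \<and> poly P (real i) = 1 + real (digits_value B xs)"
      using P(2) by (force simp: A_def)
    then obtain X where X: "\<And>i. i < k \<Longrightarrow> X i \<in> W"
        "\<And>i. i < k \<Longrightarrow> poly P (real i) = 1 + real (digits_value B (X i))"
      by metis
    have XV: "set (X i) \<subseteq> {..<b} \<and> length (X i) = d" if "i < k" for i
      using X(1)[OF that] by (simp add: W_def V_def)
    \<comment> \<open>The values of the digit strings, hence the digits, satisfy the difference equation.\<close>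
    have vz: "(fdiff ^^ Suc D) (\<lambda>i. int (digits_value B (X i))) i = 0" if "i + Suc D < k" for i
    proof -
      have "real_of_int ((fdiff ^^ Suc D) (\<lambda>i. int (digits_value B (X i))) i)
          = (fdiff ^^ Suc D) (\<lambda>i. real_of_int (int (digits_value B (X i)))) i"
        by (rule fdiff_pow_of_int[symmetric])
      also have "\<dots> = (fdiff ^^ Suc D) (\<lambda>i. poly (P - 1) (real i)) i"
        by (rule fdiff_pow_cong) (use X(2) that in auto)
      also have "\<dots> = 0"
        by (rule fdiff_pow_poly) (use P(1) degree_diff_le[of P D 1] in simp)
      finally show ?thesis by simp
    qed
    have "\<exists>p. degree p \<le> D \<and> (\<forall>i<k. poly p (real i) = real (X i ! j))" if "j < d" for j
    proof (rule fdiff_pow_zero_imp_poly)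
      fix i assume i: "i + Suc D < k"
      have "(fdiff ^^ Suc D) (\<lambda>i. real_of_int (int (X i ! j))) i
          = real_of_int ((fdiff ^^ Suc D) (\<lambda>i. int (X i ! j)) i)"
        by (rule fdiff_pow_of_int)
      also have "(fdiff ^^ Suc D) (\<lambda>i. int (X i ! j)) i = 0"
        by (rule fdiff_pow_digits_zero[where B = B]) (use XV vz that i in \<open>auto simp: B_def\<close>)
      finally show "(fdiff ^^ Suc D) (\<lambda>i. real (X i ! j)) i = 0" by simp
    qed
    then obtain p where p: "\<And>j. j < d \<Longrightarrow> degree (p j) \<le> D"
        "\<And>j i. j < d \<Longrightarrow> i < k \<Longrightarrow> poly (p j) (real i) = real (X i ! j)"
      by metis
    \<comment> \<open>The squared digits sum to a progression of degree at most \<open>2D\<close> in a translate of \<open>A'\<close>.\<close>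
    define q where "q = (\<Sum>j<d. (p j)\<^sup>2)"
    have "degree (q + [:of_int t:]) \<le> 2 * D"
      unfolding q_def using p(1)
      by (intro degree_add_le degree_sum_le) (auto intro!: order_trans[OF degree_power_le])
    moreover have "poly (q + [:of_int t:]) (real i) \<in> real ` A'" if i: "i < k" for i
    proof -
      have "poly q (real i) = (\<Sum>j<d. (real (X i ! j))\<^sup>2)"
        using p(2) that by (simp add: q_def poly_sum)
      also have "\<dots> = real (N2 (X i))"
        using XV[OF that] by (simp add: N2_def sum_list_sum_nth atLeast0LessThan)
      finally have "poly (q + [:of_int t:]) (real i) = of_int (int (N2 (X i)) + t)" by simp
      moreover obtain a where "a \<in> A'" "int (N2 (X i)) + t = int a"
        using X(1)[OF i] by (auto simp: W_def)
      ultimately show ?thesis by simp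
    qed
    ultimately have "degree (q + [:of_int t:]) = 0"
      using A'(2) unfolding poly_prog_free_def by blast
    then have "degree q = 0"
      using degree_diff_le[of "q + [:of_int t:]" 0 "[:of_int t:]"] by simp
    then have c: "degree (p j) = 0" if "j < d" for j
      unfolding q_def using that by (rule degree_zero_if_sum_squares_const)
    have const: "X i = X 0" if "i < k" for i
    proof (rule nth_equalityI)
      fix j assume "j < length (X i)"
      then have "j < d" using XV[OF that] by simp
      from degree_eq_zeroE[OF c[OF this]] obtain a where "p j = [:a:]" by blast
      then show "X i ! j = X 0 ! j" using p(2)[OF \<open>j < d\<close>, of i] p(2)[OF \<open>j < d\<close>, of 0] that by simp
    qed (use XV[OF that] XV[of 0] that in simp)
    have "P = [:1 + real (digits_value B (X 0)):]"
    proof (rule poly_eq_if_agree[of P D _ k])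
      fix i assume "i < k"
      with X(2)[of i] const[of i]
      show "poly P (real i) = poly [:1 + real (digits_value B (X 0)):] (real i)" by simp
    qed (use P(1) \<open>D < k\<close> in auto)
    then show "degree P = 0" by simp
  qed
  ultimately show ?thesis unfolding B_def M_def by blast
qed

section \<open>Rankin's lower bound\<close>

lemma log_le_fractions_for_large:
  "\<exists>x0\<ge>1. \<forall>x\<ge>x0. log 2 (4 * x) \<le> x / 3 \<and> K + log 2 (4 * x) \<le> x / 4" for K :: real
proof -
  have "eventually (\<lambda>x. log 2 (4 * x) \<le> x / 3 \<and> K + log 2 (4 * x) \<le> x / 4) at_top"
    by (intro eventually_conj; real_asymp)
  then obtain x0 where "\<forall>x\<ge>x0. log 2 (4 * x) \<le> x / 3 \<and> K + log 2 (4 * x) \<le> x / 4"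
    by (auto simp: eventually_at_top_linorder)
  then show ?thesis by (intro exI[of _ "max 1 x0"]) auto
qed

text \<open>Iteration of \<open>poly_prog_free_lift\<close>. In the step from \<open>m\<close> to \<open>m + 1\<close>, with
  \<open>L = log\<^sub>2 N\<close> and \<open>x = L\<^bsup>1/(m+2)\<^esup>\<close>, take about \<open>3x\<close> digits, in a
  base about \<open>N\<^bsup>1/d\<^esup>\<close>. The factor \<open>2\<^sup>D\<close> lost in each digit costs \<open>3Dx\<close> in the exponent. The sums
  of squares range up to \<open>M = d b\<^sup>2\<close> with \<open>log\<^sub>2 M \<le> 2 L/d + log\<^sub>2 d \<le> x\<^bsup>m+1\<^esup>\<close>, so the
  induction hypothesis for \<open>2D\<close> costs a multiple of \<open>(x\<^bsup>m+1\<^esup>)\<^bsup>1/(m+1)\<^esup> = x\<close> as well. With fewer than about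
  \<open>2x\<close> digits the term \<open>2 L/d\<close> alone would exceed \<open>x\<^bsup>m+1\<^esup>\<close>; the coefficient 3 makes it
  \<open>2/3 x\<^bsup>m+1\<^esup>\<close>, which leaves room for \<open>log\<^sub>2 d\<close>.\<close>

lemma poly_prog_free_dense:
  assumes "2 ^ m * D < k"
  shows "\<exists>C. \<forall>N\<ge>1. \<exists>A \<subseteq> {1..N}. poly_prog_free k D A \<and>
    real N * 2 powr - ((1 + 3 * real D * (2 ^ m - 1)) * log 2 (real N) powr (1 / (real m + 1)) + C)
      \<le> real (card A)"
  using assms
proof (induction m arbitrary: D)
  case 0
  show ?case
  proof (rule exI[of _ 0]; intro allI impI)
    fix N :: nat assume "N \<ge> 1"
    then have "real N * 2 powr - ((1 + 3 * real D * (2 ^ 0 - 1)) * log 2 (real N) powr (1 / (real 0 + 1)) + 0) = 1"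
      by (simp add: powr_minus)
    then show "\<exists>A \<subseteq> {1..N}. poly_prog_free k D A \<and>
      real N * 2 powr - ((1 + 3 * real D * (2 ^ 0 - 1)) * log 2 (real N) powr (1 / (real 0 + 1)) + 0)
        \<le> real (card A)"
      using poly_prog_free_singleton[of D k 1] 0 \<open>N \<ge> 1\<close> by (intro exI[of _ "{1}"]) simp
  qed
next
  case (Suc m)
  define a where "a = 1 + 3 * real (2 * D) * (2 ^ m - 1)"
  have "2 ^ m * (2 * D) < k" using Suc.prems by simp
  from Suc.IH[OF this] obtain C' where C': "\<And>M. M \<ge> 1 \<Longrightarrow> \<exists>A \<subseteq> {1..M}. poly_prog_free k (2 * D) A \<and>
      real M * 2 powr - (a * log 2 (real M) powr (1 / (real m + 1)) + C') \<le> real (card A)"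
    unfolding a_def by blast
  obtain l0 :: real where l0: "l0 \<ge> 1" "\<And>x. x \<ge> l0 \<Longrightarrow> log 2 (4 * x) \<le> x / 3"
      "\<And>x. x \<ge> l0 \<Longrightarrow> (D + 1) + log 2 (4 * x) \<le> x / 4"
    using log_le_fractions_for_large[of "D + 1"] by blast
  have "D < k"
  proof -
    have "1 * D \<le> 2 ^ Suc m * D" by (intro mult_right_mono) auto
    then show ?thesis using Suc.prems by linarith
  qed
  have a0: "a \<ge> 1" by (simp add: a_def)
  have coef: "1 + 3 * real D * (2 ^ Suc m - 1) = 3 * D + a"
    by (simp add: a_def algebra_simps)
  \<comment> \<open>The first entry collects the losses of one step. The second makes the bound at most 1 for
    small \<open>N\<close>, where a singleton suffices.\<close>
  define C where "C = max (D + 2 + C') (l0 ^ (m + 2))"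
  show ?case
  proof (rule exI[of _ C]; intro allI impI)
    fix N :: nat assume N: "N \<ge> 1"
    define L where "L = log 2 (real N)"
    define x where "x = L powr (1 / (real (Suc m) + 1))"
    have L0: "L \<ge> 0" using N by (simp add: L_def)
    have x0: "x \<ge> 0" by (simp add: x_def)
    have xL: "x ^ (m + 2) = L"
    proof (cases "L = 0")
      case False
      then have "x ^ (m + 2) = x powr real (m + 2)"
        using L0 by (subst powr_realpow) (auto simp: x_def)
      also have "\<dots> = L powr ((1 / (real (Suc m) + 1)) * real (m + 2))"
        unfolding x_def powr_powr ..
      also have "(1 / (real (Suc m) + 1)) * real (m + 2) = 1" by (simp add: field_simps)
      finally show ?thesis using L0 by simp
    qed (simp add: x_def)
    have N2: "2 powr L = N" unfolding L_def using N by simp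
    have "\<exists>A \<subseteq> {1..N}. poly_prog_free k D A \<and> real N * 2 powr - ((3 * D + a) * x + C) \<le> real (card A)"
    proof (cases "x \<ge> l0")
      case False
      have "L \<le> l0 ^ (m + 2)"
        unfolding xL[symmetric] using False x0 by (intro power_mono) auto
      also have "\<dots> \<le> C" by (simp add: C_def)
      also have "\<dots> \<le> (3 * D + a) * x + C" using a0 x0 by simp
      finally have "2 powr - ((3 * D + a) * x + C) \<le> 2 powr - L" by simp
      then have "real N * 2 powr - ((3 * D + a) * x + C) \<le> real N * 2 powr - L"
        by (intro mult_left_mono) auto
      also have "\<dots> = 1" using N by (simp add: powr_minus N2)
      finally show ?thesis
        using poly_prog_free_singleton[OF \<open>D < k\<close>, of 1] N by (intro exI[of _ "{1}"]) simp
    next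
      case True
      then have x1: "x \<ge> 1" using l0 by simp
      define d where "d = nat \<lceil>3 * x\<rceil>"
      have d: "3 * x \<le> d" "d \<le> 3 * x + 1" "d > 0"
        using x1 unfolding d_def by linarith+
      have d4: "d \<le> 4 * x" using d x1 by simp
      define Y where "Y = real N powr (1 / d) / 2 ^ D"
      define b where "b = nat \<lfloor>Y\<rfloor>"
      have Y0: "Y > 0" using N by (simp add: Y_def)
      have logY: "log 2 Y = L / d - D"
        unfolding Y_def L_def using N by (simp add: log_divide log_powr log_nat_power)
      have xm: "x \<le> x ^ (m + 1)"
        using x1 power_increasing[of 1 "m + 1" x] by simp
      have "x ^ (m + 1) * (4 * x) = 4 * L" by (simp add: xL[symmetric])
      then have "x ^ (m + 1) / 4 = L / (4 * x)" using x1 by (simp add: field_simps)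
      also have "\<dots> \<le> L / d" using d4 d L0 x1 by (intro divide_left_mono) auto
      finally have Ld1: "x ^ (m + 1) / 4 \<le> L / d" .
      have "L / d \<le> L / (3 * x)" using d L0 x1 by (intro divide_left_mono) auto
      also have "\<dots> = x ^ (m + 1) / 3" using x1 by (simp add: xL[symmetric] field_simps)
      finally have Ld2: "L / d \<le> x ^ (m + 1) / 3" .
      have "log 2 (2 * d) = 1 + log 2 d" using d by (simp add: log_mult)
      also have "log 2 d \<le> log 2 (4 * x)" using d d4 by simp
      also have "1 + log 2 (4 * x) \<le> x / 4 - D" using l0(3)[OF True] by simp
      also have "\<dots> \<le> log 2 Y" using logY Ld1 xm by simp
      finally have Yd: "2 * d \<le> Y" using Y0 d by simp
      have Y2: "Y \<ge> 2" using Yd d by linarith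
      have b: "b \<le> Y" "Y - 1 \<le> b" "b > 0" using Y2 unfolding b_def by linarith+
      have Yd_eq: "Y ^ d * 2 ^ (D * d) = N"
      proof -
        have "Y ^ d * 2 ^ (D * d) = (Y * 2 ^ D) ^ d" by (simp add: power_mult power_mult_distrib)
        also have "Y * 2 ^ D = real N powr (1 / d)" by (simp add: Y_def)
        also have "\<dots> ^ d = N"
          using N d by (simp add: powr_realpow[symmetric] powr_powr)
        finally show ?thesis .
      qed
      have fits: "(2 ^ D * b) ^ d \<le> N"
      proof -
        have "(2 ^ D * real b) ^ d \<le> (2 ^ D * Y) ^ d"
          using b by (intro power_mono mult_left_mono) auto
        also have "\<dots> = N" unfolding Yd_eq[symmetric]
          by (simp add: power_mult power_mult_distrib)
        finally have "real ((2 ^ D * b) ^ d) \<le> real N" by simp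
        then show ?thesis by (simp only: of_nat_le_iff)
      qed
      \<comment> \<open>Rounding \<open>Y\<close> down to \<open>b\<close> loses at most a factor 2 in total, by Bernoulli and \<open>Y \<ge> 2d\<close>.\<close>
      have bd: "N / 2 ^ (D * d) / 2 \<le> real b ^ d"
      proof -
        have "1 / 2 \<le> 1 + real d * (- 1 / Y)" using Yd Y0 by (simp add: field_simps)
        also have "\<dots> \<le> (1 + - 1 / Y) ^ d" using Y2 by (intro Bernoulli_inequality) (simp add: field_simps)
        finally have "Y ^ d * (1 / 2) \<le> Y ^ d * (1 + - 1 / Y) ^ d"
          using Y0 by (intro mult_left_mono) auto
        also have "\<dots> = (Y - 1) ^ d"
          using Y0 by (simp add: power_mult_distrib[symmetric] field_simps)
        also have "\<dots> \<le> real b ^ d" using b Y2 by (intro power_mono) auto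
        finally show ?thesis unfolding Yd_eq[symmetric] by simp
      qed
      define M where "M = d * b\<^sup>2"
      have M1: "M \<ge> 1" using d b by (simp add: M_def Suc_le_eq)
      have "log 2 M = log 2 d + 2 * log 2 b"
        using d b by (simp add: M_def log_mult log_nat_power)
      also have "log 2 d \<le> log 2 (4 * x)" using d d4 by simp
      also have "\<dots> \<le> x / 3" using l0(2)[OF True] .
      also have "log 2 b \<le> log 2 Y" using b Y0 by simp
      also have "log 2 Y \<le> x ^ (m + 1) / 3" using logY Ld2 by simp
      also have "x / 3 + 2 * (x ^ (m + 1) / 3) \<le> x ^ (m + 1)" using xm by simp
      finally have logM: "log 2 M \<le> x ^ (m + 1)" by simp
      have "log 2 M powr (1 / (real m + 1)) \<le> (x ^ (m + 1)) powr (1 / (real m + 1))"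
        using logM M1 by (intro powr_mono2) auto
      also have "\<dots> = (x powr real (m + 1)) powr (1 / (real m + 1))"
        using x1 by (subst powr_realpow) auto
      also have "\<dots> = x powr (real (m + 1) * (1 / (real m + 1)))" by (rule powr_powr)
      also have "real (m + 1) * (1 / (real m + 1)) = 1" by (simp add: field_simps)
      also have "x powr 1 = x" using x1 by simp
      finally have rootM: "log 2 M powr (1 / (real m + 1)) \<le> x" .
      obtain A' where A': "A' \<subseteq> {1..M}" "poly_prog_free k (2 * D) A'"
          "real M * 2 powr - (a * log 2 (real M) powr (1 / (real m + 1)) + C') \<le> real (card A')"
        using C'[OF M1] by blast
      obtain A where A: "A \<subseteq> {1..(2 ^ D * b) ^ d}" "poly_prog_free k D A"
          "b ^ d * card A' \<le> 2 * M * card A"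
        using poly_prog_free_lift[OF \<open>D < k\<close> b(3) d(3) A'(1,2)[unfolded M_def]]
        unfolding M_def by blast
      define F where "F = 2 powr - (a * x + C')"
      have "real M * F \<le> real M * 2 powr - (a * log 2 (real M) powr (1 / (real m + 1)) + C')"
        unfolding F_def using rootM a0 by (intro mult_left_mono) auto
      then have MF: "real M * F \<le> card A'" using A'(3) by linarith
      have "real M * (real b ^ d * F) \<le> real b ^ d * card A'"
        using mult_left_mono[OF MF, of "real b ^ d"] by (simp add: mult_ac)
      also have "\<dots> \<le> real M * (2 * card A)"
        using A(3) by (metis (mono_tags, lifting) mult.assoc mult.commute of_nat_le_iff of_nat_mult of_nat_power of_nat_numeral)
      finally have bF: "real b ^ d * F \<le> 2 * card A" using M1 by simp
      have "N / 2 ^ (D * d) / 2 * F \<le> real b ^ d * F"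
        using bd by (intro mult_right_mono) (auto simp: F_def)
      with bF have 1: "N / 2 ^ (D * d) * F / 4 \<le> card A" by simp
      have "real D * d \<le> D * (3 * x + 1)" using d by (intro mult_left_mono) auto
      then have le: "D * d + a * x + C' + 2 \<le> (3 * D + a) * x + C"
        by (simp add: algebra_simps C_def)
      have "real N * 2 powr - ((3 * D + a) * x + C) \<le> real N * 2 powr - (D * d + a * x + C' + 2)"
        using le by (intro mult_left_mono) auto
      also have "2 powr - (D * d + a * x + C' + 2) = 2 powr (- real (D * d)) * F * 2 powr (- 2)"
        unfolding F_def by (simp add: powr_add[symmetric] algebra_simps)
      also have "2 powr (- real (D * d)) = 1 / 2 ^ (D * d)"
        unfolding powr_minus by (subst powr_realpow) (simp_all add: field_simps)
      also have "real N * (1 / 2 ^ (D * d) * F * 2 powr (- 2)) = N / 2 ^ (D * d) * F / 4"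
        by (simp add: powr_minus)
      finally have "real N * 2 powr - ((3 * D + a) * x + C) \<le> card A" using 1 by simp
      moreover have "A \<subseteq> {1..N}" using A(1) fits by force
      ultimately show ?thesis using A(2) by blast
    qed
    then show "\<exists>A \<subseteq> {1..N}. poly_prog_free k D A \<and>
      real N * 2 powr - ((1 + 3 * real D * (2 ^ Suc m - 1)) *
        log 2 (real N) powr (1 / (real (Suc m) + 1)) + C) \<le> real (card A)"
      unfolding coef x_def L_def .
  qed
qed

section \<open>Line-free sets from progression-free sets\<close>

lemma card_le_r_num:
  assumes "A \<subseteq> {1..m}" "ap_free k A"
  shows "card A \<le> r_num k m"
proof -
  have "finite {card A | A. A \<subseteq> {1..m} \<and> ap_free k A}"
    by (rule finite_subset[of _ "card ` Pow {1..m}"]) auto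
  then show ?thesis unfolding r_num_def using assms by (intro Max_ge) auto
qed

lemma r_num_attained:
  assumes "k > 0"
  obtains A where "A \<subseteq> {1..m}" "ap_free k A" "card A = r_num k m"
proof -
  have "finite {card A | A. A \<subseteq> {1..m} \<and> ap_free k A}"
    by (rule finite_subset[of _ "card ` Pow {1..m}"]) auto
  moreover have "{} \<subseteq> {1..m} \<and> ap_free k {}" using assms by (auto simp: ap_free_def)
  then have "{card A | A. A \<subseteq> {1..m} \<and> ap_free k A} \<noteq> {}" by blast
  ultimately have "r_num k m \<in> {card A | A. A \<subseteq> {1..m} \<and> ap_free k A}"
    unfolding r_num_def by (rule Max_in)
  then show ?thesis using that by auto
qed

lemma r_num_le:
  assumes "k > 0"
  shows "r_num k m \<le> m"
proof -
  obtain A where "A \<subseteq> {1..m}" "card A = r_num k m" using r_num_attained[OF assms] .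
  then show ?thesis using card_mono[of "{1..m}" A] by simp
qed

lemma finite_words: "finite (words k n)"
  unfolding words_def by (rule finite_lists_length_eq) simp

lemma card_words: "card (words k n) = k ^ n"
  unfolding words_def by (subst card_lists_length_eq) auto

lemma card_le_c_num:
  assumes "line_free k n A"
  shows "card A \<le> c_num n k"
proof -
  have "finite {card A | A. line_free k n A}"
    by (rule finite_subset[of _ "card ` Pow (words k n)"])
       (auto simp: line_free_def finite_words)
  then show ?thesis unfolding c_num_def using assms by (intro Max_ge) auto
qed

text \<open>The letter sum is affine in the letter substituted for the wildcard, and its slope is the number of
  wildcards.\<close>

lemma sum_list_fill: "sum_list (fill w i) = sum_list (fill w 0) + i * count_list w None"
  by (induction w) (auto simp: fill_def split: option.split)

lemma line_free_if_ap_free: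
  assumes "ap_free k S"
  shows "line_free k n {w \<in> words k n. int (sum_list w) + t \<in> int ` S}"
  unfolding line_free_def
proof (intro conjI notI)
  assume "\<exists>L. combinatorial_line k n L \<and> L \<subseteq> {w \<in> words k n. int (sum_list w) + t \<in> int ` S}"
  then obtain w where w: "w \<in> templates k n"
      "\<And>i. i \<in> {1..k} \<Longrightarrow> int (sum_list (fill w i)) + t \<in> int ` S"
    unfolding combinatorial_line_def by blast
  define r where "r = count_list w None"
  have "r > 0" using w(1) unfolding r_def templates_def by (simp add: count_list_0_iff neq0_conv[symmetric] del: neq0_conv)
  have "k > 0" using assms by (cases "k = 0") (auto simp: ap_free_def)
  have S: "int (sum_list (fill w 0)) + int (Suc i * r) + t \<in> int ` S" if "i < k" for i
    using w(2)[of "Suc i"] that sum_list_fill[of w "Suc i"] by (simp add: r_def)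
  then obtain a where a: "int (sum_list (fill w 0)) + int r + t = int a" using \<open>k > 0\<close> by force
  have "a + i * r \<in> S" if "i < k" for i
  proof -
    have "int (sum_list (fill w 0)) + int (Suc i * r) + t = int (a + i * r)" using a by simp
    then show ?thesis using S[OF that] by (metis image_iff of_nat_eq_iff)
  qed
  with assms \<open>r > 0\<close> show False unfolding ap_free_def by blast
qed auto

text \<open>Twice the signed distance of the letter sum from its mean, which is \<open>n (k + 1) / 2\<close> for words of length
  \<open>n\<close>; the factor 2 keeps it an integer.\<close>

definition deviation :: "nat \<Rightarrow> nat list \<Rightarrow> int" where
  "deviation k w = (\<Sum>a\<leftarrow>w. 2 * int a - int k - 1)"

lemma deviation_eq: "deviation k w = 2 * int (sum_list w) - int (length w) * (int k + 1)"
  by (induction w) (simp_all add: deviation_def algebra_simps)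

lemma sum_words_Suc:
  "(\<Sum>w\<in>words k (Suc n). f w) = (\<Sum>a\<in>{1..k}. \<Sum>w\<in>words k n. f (a # w))"
proof -
  have "words k (Suc n) = (\<lambda>(a, w). a # w) ` ({1..k} \<times> words k n)"
  proof (intro equalityI subsetI)
    fix v assume "v \<in> words k (Suc n)"
    then obtain a w where "v = a # w" "a \<in> {1..k}" "w \<in> words k n"
      by (auto simp: words_def length_Suc_conv)
    then show "v \<in> (\<lambda>(a, w). a # w) ` ({1..k} \<times> words k n)" by blast
  qed (auto simp: words_def)
  moreover have "inj_on (\<lambda>(a, w). a # w) ({1..k} \<times> words k n)" by (auto simp: inj_on_def)
  ultimately show ?thesis
    by (simp add: sum.reindex sum.cartesian_product case_prod_unfold comp_def)
qed

lemma sum_centred_letters: "(\<Sum>a=1..k. 2 * int a - int k - 1) = 0"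
proof -
  have "(\<Sum>a=1..k. 2 * int a - c) = int k * (int k + 1 - c)" for c
    by (induction k) (simp_all add: algebra_simps)
  from this[of "int k + 1"] show ?thesis by (simp add: algebra_simps)
qed

lemma sum_deviation: "(\<Sum>w\<in>words k n. deviation k w) = 0"
proof (induction n)
  case 0
  have "words k 0 = {[]}" by (auto simp: words_def)
  then show ?case by (simp add: deviation_def)
next
  case (Suc n)
  have "(\<Sum>w\<in>words k (Suc n). deviation k w)
      = (\<Sum>a=1..k. \<Sum>w\<in>words k n. (2 * int a - int k - 1) + deviation k w)"
    by (simp add: sum_words_Suc deviation_def)
  also have "\<dots> = int (k ^ n) * (\<Sum>a=1..k. 2 * int a - int k - 1)"
    by (simp only: sum.distrib Suc sum_constant card_words sum_distrib_left)
  also have "\<dots> = 0" unfolding sum_centred_letters by simp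
  finally show ?case .
qed

text \<open>A second moment of a sum of independent centred letters, each contributing at most \<open>k\<^sup>2\<close>; the mixed terms vanish by
  \<open>sum_deviation\<close>.\<close>

lemma sum_deviation_squared:
  "(\<Sum>w\<in>words k n. (deviation k w)\<^sup>2) \<le> int (k ^ n) * (int n * (int k)\<^sup>2)"
proof (induction n)
  case 0
  have "words k 0 = {[]}" by (auto simp: words_def)
  then show ?case by (simp add: deviation_def)
next
  case (Suc n)
  define V where "V = (\<Sum>w\<in>words k n. (deviation k w)\<^sup>2)"
  have inner: "(\<Sum>w\<in>words k n. (deviation k (a # w))\<^sup>2)
      \<le> int (k ^ n) * (int k)\<^sup>2 + V" if "a \<in> {1..k}" for a
  proof -
    define c where "c = 2 * int a - int k - 1"
    have "(\<Sum>w\<in>words k n. (deviation k (a # w))\<^sup>2)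
        = (\<Sum>w\<in>words k n. c\<^sup>2 + (2 * c * deviation k w + (deviation k w)\<^sup>2))"
      by (intro sum.cong refl) (simp add: deviation_def c_def power2_eq_square algebra_simps)
    also have "\<dots> = int (k ^ n) * c\<^sup>2 + V"
      by (simp add: sum.distrib V_def card_words sum_distrib_left[symmetric] sum_deviation)
    also have "c\<^sup>2 \<le> (int k)\<^sup>2"
      using that by (intro abs_le_square_iff[THEN iffD1]) (auto simp: c_def)
    finally show ?thesis by (simp add: mult_left_mono)
  qed
  have "(\<Sum>w\<in>words k (Suc n). (deviation k w)\<^sup>2) \<le> (\<Sum>a\<in>{1..k}. int (k ^ n) * (int k)\<^sup>2 + V)"
    unfolding sum_words_Suc by (rule sum_mono) (rule inner)
  also have "\<dots> = int k * (int (k ^ n) * (int k)\<^sup>2 + V)" by simp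
  also have "\<dots> \<le> int k * (int (k ^ n) * (int k)\<^sup>2 + int (k ^ n) * (int n * (int k)\<^sup>2))"
    using Suc by (intro mult_left_mono add_left_mono) (auto simp: V_def)
  also have "\<dots> = int (k ^ Suc n) * (int (Suc n) * (int k)\<^sup>2)" by (simp add: algebra_simps)
  finally show ?case .
qed

text \<open>Chebyshev's inequality, with twice the bound on the variance as threshold.\<close>

lemma half_words_concentrated:
  assumes "k > 0" "n > 0"
  shows "k ^ n \<le> 2 * card {w \<in> words k n. (deviation k w)\<^sup>2 \<le> 2 * int n * (int k)\<^sup>2}"
proof -
  let ?G = "{w \<in> words k n. (deviation k w)\<^sup>2 \<le> 2 * int n * (int k)\<^sup>2}"
  let ?B = "words k n - ?G"
  have pos: "int n * (int k)\<^sup>2 > 0" using assms by simp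
  have "(2 * int (card ?B)) * (int n * (int k)\<^sup>2) = (\<Sum>w\<in>?B. 2 * int n * (int k)\<^sup>2)" by simp
  also have "\<dots> \<le> (\<Sum>w\<in>?B. (deviation k w)\<^sup>2)" by (intro sum_mono) auto
  also have "\<dots> \<le> (\<Sum>w\<in>words k n. (deviation k w)\<^sup>2)"
    by (intro sum_mono2) (auto simp: finite_words)
  also have "\<dots> \<le> int (k ^ n) * (int n * (int k)\<^sup>2)" by (rule sum_deviation_squared)
  finally have "2 * int (card ?B) \<le> int (k ^ n)"
    by (rule mult_right_le_imp_le[OF _ pos])
  then have "2 * card ?B \<le> k ^ n" by linarith
  moreover have "card ?B = k ^ n - card ?G"
    by (subst card_Diff_subset) (auto simp: finite_words card_words)
  moreover have "card ?G \<le> k ^ n"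
    unfolding card_words[symmetric] by (intro card_mono finite_words) auto
  ultimately show ?thesis by linarith
qed

text \<open>The translates of an optimal progression-free set \<open>S \<subseteq> {1..m}\<close>, \<open>m = \<lfloor>\<surd>n\<rfloor>\<close>, that meet the typical letter
  sums number at most \<open>7 m k\<close>. The best of them catches its share of at least half of all words, and
  its preimage is line-free.\<close>

lemma c_num_ge_r_num:
  assumes "k > 0" "n > 0"
  shows "real k ^ n / (14 * k) * (r_num k (nat \<lfloor>sqrt n\<rfloor>) / sqrt n) \<le> c_num n k"
proof -
  define m where "m = nat \<lfloor>sqrt n\<rfloor>"
  have m: "m \<le> sqrt n" "sqrt n < m + 1" "m \<ge> 1"
    using assms(2) unfolding m_def by (simp_all add: le_nat_iff) linarith?
  obtain S where S: "S \<subseteq> {1..m}" "ap_free k S" "card S = r_num k m"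
    using r_num_attained[OF assms(1)] .
  define G where "G = {w \<in> words k n. (deviation k w)\<^sup>2 \<le> 2 * int n * (int k)\<^sup>2}"
  have G: "k ^ n \<le> 2 * card G" unfolding G_def by (rule half_words_concentrated[OF assms])
  \<comment> \<open>The mean of the letter sum, rounded down; the rounding accounts for the \<open>+ 1\<close> in \<open>dev\<close>.\<close>
  define c where "c = int n * (int k + 1) div 2"
  have n_less: "n \<le> (2 * m)\<^sup>2"
  proof -
    have "real n = (sqrt n)\<^sup>2" by simp
    also have "\<dots> \<le> (2 * real m)\<^sup>2" using m by (intro power_mono) auto
    finally have "real n \<le> real ((2 * m)\<^sup>2)" by simp
    then show ?thesis by (simp only: of_nat_le_iff)
  qed
  have dev: "\<bar>int (sum_list w) - c\<bar> \<le> 2 * int (m * k) + 1" if "w \<in> G" for w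
  proof -
    have "(deviation k w)\<^sup>2 \<le> 2 * int n * (int k)\<^sup>2" using that by (simp add: G_def)
    also have "\<dots> \<le> 2 * int ((2 * m)\<^sup>2) * (int k)\<^sup>2"
      using n_less by (intro mult_right_mono mult_left_mono of_nat_mono n_less) simp_all
    also have "\<dots> \<le> (4 * int (m * k))\<^sup>2" by (simp add: power2_eq_square algebra_simps)
    finally have "\<bar>deviation k w\<bar> \<le> 4 * int (m * k)" using power2_le_iff_abs_le[of "4 * int (m * k)"] by simp
    moreover have "deviation k w = 2 * int (sum_list w) - int n * (int k + 1)"
      using that by (simp add: deviation_eq G_def words_def)
    ultimately show ?thesis unfolding c_def by linarith
  qed
  let ?T = "{- c - 2 * int (m * k)..int m - c + 2 * int (m * k) + 1}"
  have "\<exists>t\<in>?T. card G * card (int ` S) \<le> card ?T * card {w \<in> G. int (sum_list w) + t \<in> int ` S}"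
  proof (rule exists_good_translate)
    fix w s assume "w \<in> G" "s \<in> int ` S"
    then have "1 \<le> s" "s \<le> int m" using S(1) by force+
    with dev[OF \<open>w \<in> G\<close>] show "s - int (sum_list w) \<in> ?T" by auto
  qed (use S(1) in \<open>auto simp: G_def finite_words intro: finite_subset\<close>)
  then obtain t where t: "card G * card (int ` S) \<le> card ?T * card {w \<in> G. int (sum_list w) + t \<in> int ` S}"
    by blast
  have "m \<le> m * k" using assms by simp
  moreover have "card ?T = nat (int (m + 4 * (m * k) + 2))" by (simp add: algebra_simps)
  ultimately have T: "card ?T \<le> 7 * (m * k)" using m(3) unfolding nat_int by linarith
  have "card {w \<in> G. int (sum_list w) + t \<in> int ` S} \<le> card {w \<in> words k n. int (sum_list w) + t \<in> int ` S}"
    by (intro card_mono) (auto simp: finite_words G_def)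
  also have "\<dots> \<le> c_num n k"
    by (rule card_le_c_num[OF line_free_if_ap_free[OF S(2)]])
  finally have "card ?T * card {w \<in> G. int (sum_list w) + t \<in> int ` S} \<le> 7 * (m * k) * c_num n k"
    using T by (rule mult_le_mono[rotated])
  with t have "card G * r_num k m \<le> 7 * (m * k) * c_num n k"
    using S(3) by (simp add: card_image)
  moreover have "k ^ n * r_num k m \<le> 2 * card G * r_num k m" using G by (rule mult_le_mono1)
  ultimately have "k ^ n * r_num k m \<le> 14 * (m * k) * c_num n k" by linarith
  then have "real (k ^ n * r_num k m) \<le> real (14 * (m * k) * c_num n k)" by (simp only: of_nat_le_iff)
  then have "real k ^ n * r_num k m \<le> real m * real (14 * k * c_num n k)" by (simp add: mult_ac)
  also have "\<dots> \<le> sqrt n * real (14 * k * c_num n k)" using m(1) by (rule mult_right_mono) simp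
  finally show ?thesis using assms unfolding m_def[symmetric] by (simp add: field_simps)
qed

section \<open>Comparison of the constants\<close>

text \<open>The tangent to the logarithm at the point where it has slope \<open>e / B\<close>.\<close>

lemma ln_le_linear:
  fixes B e :: real
  assumes "B > 0" "e > 0"
  shows "\<exists>c. \<forall>z>0. B * ln z \<le> e * z + c"
proof (intro exI allI impI)
  fix z :: real assume "z > 0"
  have "ln (e / B * z) \<le> e / B * z - 1"
    using assms \<open>z > 0\<close> by (intro ln_le_minus_one) simp
  also have "ln (e / B * z) = ln (e / B) + ln z"
    using assms \<open>z > 0\<close> by (subst ln_mult_pos) auto
  finally have "B * (ln (e / B) + ln z) \<le> B * (e / B * z - 1)"
    using assms by (intro mult_left_mono) auto
  then show "B * ln z \<le> e * z + (- B - B * ln (e / B))"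
    using assms by (simp add: algebra_simps)
qed

text \<open>With \<open>P = 2\<^bsup>l-1\<^esup> \<le> k - 1\<close> the left side is \<open>3P - 2\<close>. For \<open>l \<ge> 3\<close> it is below \<open>l P\<close>; for \<open>l = 2\<close> it is 4,
  and the right side is at least \<open>4 \<surd>2\<close>.\<close>

lemma rankin_constant_less:
  assumes "2 ^ (l - 1) < k" "l \<ge> 2"
  shows "1 + 3 * (2 ^ (l - 1) - 1) < (real k - 1) * (real l * 2 powr ((real l - 1) / 2))"
proof -
  define P :: real where "P = 2 ^ (l - 1)"
  define E where "E = real l * 2 powr ((real l - 1) / 2)"
  have k: "P \<le> real k - 1"
  proof -
    have "Suc (2 ^ (l - 1)) \<le> k" using assms(1) by simp
    then have "real (Suc (2 ^ (l - 1))) \<le> real k" by (rule of_nat_mono)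
    then show ?thesis by (simp add: P_def)
  qed
  have P: "P > 0" by (simp add: P_def)
  have "3 * P - 2 < P * E"
  proof (cases "l = 2")
    case True
    have "1 < sqrt 2" by simp
    then show ?thesis using True by (simp add: P_def E_def powr_half_sqrt)
  next
    case False
    have "3 * 1 \<le> E" unfolding E_def
      using assms(2) False by (intro mult_mono ge_one_powr_ge_zero) auto
    then have "P * 3 \<le> P * E" using P by (intro mult_left_mono) auto
    then show ?thesis by simp
  qed
  also have "\<dots> \<le> (real k - 1) * E" using k by (intro mult_right_mono) (auto simp: E_def)
  finally show ?thesis unfolding P_def E_def by simp
qed

lemma r_num_ge_rankin:
  assumes "2 ^ m < k"
  shows "\<exists>C. \<forall>N\<ge>1. real N * 2 powr - ((1 + 3 * (2 ^ m - 1)) * log 2 N powr (1 / real (Suc m)) + C)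
           \<le> r_num k N"
proof -
  from poly_prog_free_dense[of m 1 k] assms obtain C where C: "\<And>N. N \<ge> 1 \<Longrightarrow> \<exists>A \<subseteq> {1..N}. poly_prog_free k 1 A \<and>
      real N * 2 powr - ((1 + 3 * (2 ^ m - 1)) * log 2 N powr (1 / (real m + 1)) + C) \<le> card A"
    by auto
  have "real N * 2 powr - ((1 + 3 * (2 ^ m - 1)) * log 2 N powr (1 / real (Suc m)) + C) \<le> r_num k N"
    if N: "N \<ge> 1" for N
  proof -
    obtain A where A: "A \<subseteq> {1..N}" "poly_prog_free k 1 A"
        "real N * 2 powr - ((1 + 3 * (2 ^ m - 1)) * log 2 N powr (1 / (real m + 1)) + C) \<le> card A"
      using C[OF N] by blast
    have "real (card A) \<le> r_num k N"
      using card_le_r_num[OF A(1) ap_free_if_poly_prog_free[OF A(2)]] by simp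
    then show ?thesis using A(3) by (simp add: add.commute)
  qed
  then show ?thesis by blast
qed

text \<open>Half of \<open>log\<^sub>2 n\<close> appears as the logarithm of \<open>\<surd>n\<close>; it is the source of the term \<open>-1/l\<close> in the exponent
  of 2 in \<open>alpha\<close>. Rounding \<open>\<surd>n\<close> down at most halves it, so this only affects the constant.\<close>

lemma c_num_ge_rankin:
  assumes "2 ^ m < k"
  shows "\<exists>c>0. \<forall>n\<ge>2. real k ^ n * (c * 2 powr - ((1 + 3 * (2 ^ m - 1)) * (log 2 n / 2) powr (1 / real (Suc m))))
           \<le> c_num n k"
proof -
  have "k > 0" using assms by (cases k) auto
  obtain C where C: "\<And>N. N \<ge> 1 \<Longrightarrow>
      real N * 2 powr - ((1 + 3 * (2 ^ m - 1)) * log 2 N powr (1 / real (Suc m)) + C) \<le> r_num k N"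
    using r_num_ge_rankin[OF assms] by blast
  define a :: real where "a = 1 + 3 * (2 ^ m - 1)"
  have "a \<ge> 1" by (simp add: a_def)
  define c where "c = 2 powr - C / (28 * k)"
  have "real k ^ n * (c * 2 powr - (a * (log 2 n / 2) powr (1 / real (Suc m)))) \<le> c_num n k"
    if "n \<ge> 2" for n
  proof -
    define N where "N = nat \<lfloor>sqrt n\<rfloor>"
    have "sqrt n \<ge> 1" using that by simp
    have "N \<ge> 1" "real N \<le> sqrt n" "sqrt n \<le> real N + 1"
      using \<open>sqrt n \<ge> 1\<close> unfolding N_def by linarith+
    then have N: "N \<ge> 1" "N \<le> sqrt n" "sqrt n \<le> 2 * real N" by auto
    define z where "z = (log 2 n / 2) powr (1 / real (Suc m))"
    have "log 2 N \<le> log 2 (sqrt n)"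
      using N that by (subst log_le_cancel_iff) auto
    also have "log 2 (sqrt n) = log 2 n / 2"
      using that by (simp add: powr_half_sqrt[symmetric] log_powr)
    finally have "log 2 N powr (1 / real (Suc m)) \<le> z"
      unfolding z_def using N by (intro powr_mono2) auto
    then have "a * log 2 N powr (1 / real (Suc m)) + C \<le> a * z + C" using \<open>a \<ge> 1\<close> by simp
    then have "real N * 2 powr - (a * z + C) \<le> real N * 2 powr - (a * log 2 N powr (1 / real (Suc m)) + C)"
      by (intro mult_left_mono) auto
    also have "\<dots> \<le> r_num k N" using C[OF N(1)] unfolding a_def .
    finally have r: "real N * 2 powr - (a * z + C) \<le> r_num k N" .
    have "sqrt n * 2 powr - (a * z + C) \<le> 2 * real N * 2 powr - (a * z + C)"
      using N(3) by (intro mult_right_mono) auto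
    also have "\<dots> \<le> 2 * r_num k N" using r by simp
    finally have "2 powr - (a * z + C) / 2 \<le> r_num k N / sqrt n"
      using that by (simp add: field_simps)
    then have "real k ^ n / (14 * k) * (2 powr - (a * z + C) / 2) \<le> real k ^ n / (14 * k) * (r_num k N / sqrt n)"
      by (intro mult_left_mono) auto
    also have "\<dots> \<le> c_num n k" using c_num_ge_r_num[of k n] \<open>k > 0\<close> that by (simp add: N_def)
    also have "2 powr - (a * z + C) = 2 powr - (a * z) * 2 powr - C" by (simp add: powr_add[symmetric])
    finally show ?thesis unfolding z_def[symmetric] c_def by (simp add: mult_ac)
  qed
  moreover have "c > 0" using \<open>k > 0\<close> by (simp add: c_def)
  ultimately show ?thesis unfolding a_def by blast
qed

theorem theorem1p3:
  fixes k l :: nat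
  assumes "k \<ge> 3"
    and "2 ^ l < 2 * k" and "\<And>m::nat. 2 ^ m < 2 * k \<Longrightarrow> m \<le> l"
  shows "\<exists>C>0.
      (\<forall>n\<ge>2. real (c_num n k) \<ge>
         C * real k ^ n * (real (r_num k (nat \<lfloor>sqrt (real n)\<rfloor>)) / sqrt (real n)) ^ (k - 1)) \<and>
      (\<exists>K>0. \<forall>n\<ge>2. real (c_num n k) \<ge>
         real k ^ n * exp (- (K * ln (real n) powr (1 / real l)))) \<and>
      (\<forall>n\<ge>2. real (c_num n k) \<ge>
         C * real k powr (real n - alpha k l * log (real k) (real n) powr (1 / real l)
               + beta k l * log (real k) (log (real k) (real n))))"
proof -
  have l2: "l \<ge> 2" using assms(3)[of 2] assms(1) by simp
  then have l: "Suc (l - 1) = l" by simp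
  have lk: "2 ^ (l - 1) < k" using assms(2) power_Suc[of "2::nat" "l - 1"] unfolding l by linarith
  define a :: real where "a = 1 + 3 * (2 ^ (l - 1) - 1)"
  have a1: "a \<ge> 1" by (simp add: a_def)
  obtain c where c: "c > 0" "\<And>n. n \<ge> 2 \<Longrightarrow>
      real k ^ n * (c * 2 powr - (a * (log 2 n / 2) powr (1 / real l))) \<le> c_num n k"
    using c_num_ge_rankin[OF lk] unfolding l a_def by blast

  have part1: "1 / (14 * k) * real k ^ n * (r_num k (nat \<lfloor>sqrt n\<rfloor>) / sqrt n) ^ (k - 1) \<le> c_num n k"
    if "n \<ge> 2" for n
  proof -
    define q where "q = r_num k (nat \<lfloor>sqrt n\<rfloor>) / sqrt n"
    have "real (r_num k (nat \<lfloor>sqrt n\<rfloor>)) \<le> nat \<lfloor>sqrt n\<rfloor>"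
      using r_num_le[of k] assms(1) by (intro of_nat_mono) simp
    also have "\<dots> \<le> sqrt n" by simp
    finally have q: "0 \<le> q" "q \<le> 1" using that by (simp_all add: q_def)
    have "q ^ (k - 1) \<le> q ^ 1" using q assms(1) by (intro power_decreasing) auto
    then have "real k ^ n / (14 * k) * q ^ (k - 1) \<le> real k ^ n / (14 * k) * q"
      by (intro mult_left_mono) auto
    also have "\<dots> \<le> c_num n k" unfolding q_def using c_num_ge_r_num[of k n] that assms(1) by simp
    finally show ?thesis by (simp add: q_def)
  qed

  have part2: "\<exists>K>0. \<forall>n\<ge>2. real k ^ n * exp (- (K * ln n powr (1 / real l))) \<le> c_num n k"
  proof -
    define b where "b = ln 2 * a * (1 / (2 * ln 2)) powr (1 / real l)"
    \<comment> \<open>As \<open>(ln n)\<^bsup>1/l\<^esup> \<ge> h > 0\<close> for \<open>n \<ge> 2\<close>, the constant factor \<open>c\<close> can be absorbed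
    into the exponent.\<close>
    define h where "h = ln 2 powr (1 / real l)"
    have h: "h > 0" by (simp add: h_def)
    have b: "b > 0" using a1 by (simp add: b_def)
    have "real k ^ n * exp (- ((b + \<bar>ln c\<bar> / h) * ln n powr (1 / real l))) \<le> c_num n k"
      if n: "n \<ge> 2" for n
    proof -
      define z where "z = ln n powr (1 / real l)"
      have "log 2 n / 2 = (1 / (2 * ln 2)) * ln n" by (simp add: log_def)
      then have "(log 2 n / 2) powr (1 / real l) = (1 / (2 * ln 2)) powr (1 / real l) * z"
        unfolding z_def using n by (simp only:) (subst powr_mult; simp)
      then have e: "2 powr - (a * (log 2 n / 2) powr (1 / real l)) = exp (- (b * z))"
        by (simp add: powr_def b_def mult_ac)
      have "h \<le> z" unfolding h_def z_def using n by (intro powr_mono2) auto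
      then have "\<bar>ln c\<bar> / h * h \<le> \<bar>ln c\<bar> / h * z" using h by (intro mult_left_mono) auto
      then have "- (\<bar>ln c\<bar> / h * z) \<le> ln c" using h by simp
      then have "- ((b + \<bar>ln c\<bar> / h) * z) \<le> ln c + - (b * z)" by (simp add: algebra_simps)
      then have "exp (- ((b + \<bar>ln c\<bar> / h) * z)) \<le> exp (ln c + - (b * z))" by simp
      also have "\<dots> = c * exp (- (b * z))" unfolding exp_add using c(1) by simp
      finally have "real k ^ n * exp (- ((b + \<bar>ln c\<bar> / h) * z)) \<le> real k ^ n * (c * exp (- (b * z)))"
        by (intro mult_left_mono) auto
      also have "\<dots> \<le> c_num n k" using c(2)[OF n] unfolding e .
      finally show ?thesis unfolding z_def .
    qed
    moreover have "b + \<bar>ln c\<bar> / h > 0" using b h by (intro add_pos_nonneg) auto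
    ultimately show ?thesis by blast
  qed

  \<comment> \<open>In terms of \<open>u = log\<^sub>k n\<close> the bound at hand has exponent \<open>- a g s u\<^bsup>1/l\<^esup>\<close> to base \<open>k\<close>, and \<open>alpha\<close> is the
    same expression with \<open>E\<close> for \<open>a\<close>. The difference \<open>(E - a) g s u\<^bsup>1/l\<^esup>\<close> exceeds the term with
    \<open>beta\<close> up to a constant.\<close>
  define g where "g = log k 2"
  define s where "s = (1 / (2 * g)) powr (1 / real l)"
  define E where "E = (real k - 1) * (real l * 2 powr ((real l - 1) / 2))"
  have g: "g > 0" using assms(1) by (simp add: g_def)
  have s: "s > 0" using g by (simp add: s_def)
  have aE: "a < E" unfolding a_def E_def by (rule rankin_constant_less[OF lk l2])
  have alpha: "alpha k l = E * g * s"
  proof -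
    have "s = 2 powr - (1 / real l) * g powr - (1 / real l)"
      unfolding s_def using g by (simp add: powr_divide powr_mult powr_minus field_simps)
    moreover have "g powr (1 - 1 / real l) = g * g powr - (1 / real l)"
      using powr_add[of g 1 "- (1 / real l)"] g by simp
    moreover have "2 powr ((real l - 1) / 2 - 1 / real l)
        = 2 powr ((real l - 1) / 2) * (2::real) powr - (1 / real l)"
      unfolding powr_add[symmetric] by simp
    ultimately show ?thesis
      unfolding alpha_def E_def g_def[symmetric] by (simp only: mult_ac)
  qed
  have "beta k l * real l / ln k > 0" using assms(1) l2 by (simp add: beta_def)
  then obtain c' where c': "\<And>z. z > 0 \<Longrightarrow> beta k l * real l / ln k * ln z \<le> (E - a) * g * s * z + c'"
    using ln_le_linear[of "beta k l * real l / ln k" "(E - a) * g * s"] aE g s by auto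
  define c2 where "c2 = c * real k powr - c'"
  have part3: "c2 * real k powr (real n - alpha k l * log k n powr (1 / real l)
      + beta k l * log k (log k n)) \<le> c_num n k" if n: "n \<ge> 2" for n
  proof -
    define u where "u = log k n"
    define z where "z = u powr (1 / real l)"
    have k1: "real k > 1" using assms(1) by simp
    have u: "u > 0" using n k1 by (simp add: u_def)
    have z: "z > 0" using u by (simp add: z_def)
    have "log k u = real l / ln k * ln z"
      using u l2 by (simp add: log_def z_def ln_powr)
    then have "beta k l * log k u \<le> (E - a) * g * s * z + c'" using c'[OF z] by simp
    then have le: "real n - alpha k l * z + beta k l * log k u \<le> real n + - (a * g * s * z) + c'"
      unfolding alpha by (simp add: algebra_simps)
    have "log 2 n / 2 = 1 / (2 * g) * u"
      using k1 by (simp add: u_def g_def log_def)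
    then have "(log 2 n / 2) powr (1 / real l) = s * z"
      unfolding s_def z_def using g u by (simp only:) (subst powr_mult; simp)
    moreover have "2 powr y = real k powr (g * y)" for y
      using k1 by (simp add: g_def powr_powr[symmetric])
    ultimately have e: "2 powr - (a * (log 2 n / 2) powr (1 / real l)) = real k powr - (a * g * s * z)"
      by (simp add: mult_ac)
    have "c2 * real k powr (real n - alpha k l * z + beta k l * log k u)
        \<le> c2 * real k powr (real n + - (a * g * s * z) + c')"
      using le k1 c(1) by (intro mult_left_mono powr_mono) (auto simp: c2_def)
    also have "\<dots> = real k ^ n * (c * real k powr - (a * g * s * z))"
      unfolding c2_def powr_add using k1 by (simp add: powr_realpow powr_minus)
    also have "\<dots> \<le> c_num n k" using c(2)[OF n] unfolding e .
    finally show ?thesis unfolding u_def z_def .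
  qed

  define C where "C = min (1 / (14 * k)) c2"
  have "C > 0" using assms(1) c(1) by (simp add: C_def c2_def)
  moreover have "C * real k ^ n * (r_num k (nat \<lfloor>sqrt n\<rfloor>) / sqrt n) ^ (k - 1) \<le> c_num n k"
    if "n \<ge> 2" for n
    by (rule order_trans[OF mult_right_mono[OF mult_right_mono] part1[OF that]]) (auto simp: C_def)
  moreover have "C * real k powr (real n - alpha k l * log k n powr (1 / real l)
      + beta k l * log k (log k n)) \<le> c_num n k" if "n \<ge> 2" for n
    by (rule order_trans[OF mult_right_mono part3[OF that]]) (auto simp: C_def)
  ultimately show ?thesis using part2 by blast
qed

end
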